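(* Let $\theta=\pi/5$. Write $[a,b,c,d]$ for the point $\left((a+b\sqrt5)\cos\theta,\;(c+d\sqrt5)\sin\theta\right)\in\mathbf{R}^2$, where $a,b,c,d$ are integers, and for a point $\mathbf{p}\in\mathbf{R}^2$ let $\langle \mathbf{p}\rangle$ be its decagonal orbit, i.e. the set of images of $\mathbf{p}$ under the rotations about the origin by the angles $k\pi/5$, $k=0,1,\dots,9$ (so the orbit of the origin is the single point $\{(0,0)\}$). Let $W_{50}$ be the set of $50$ vectors $$W_{50}=\langle \mathbf{a}_1\rangle\cup\langle \mathbf{b}_1\rangle\cup\langle \mathbf{c}_1\rangle\cup\langle \mathbf{d}_1\rangle\cup\langle \mathbf{e}_1\rangle,$$ where $\mathbf{a}_1=[-2,2,0,0]$, $\mathbf{b}_1=[9,-3,3,-1]$, $\mathbf{c}_1=[-9,5,-1,1]$, $\mathbf{d}_1=[-20,10,-4,2]$, $\mathbf{e}_1=[20,-8,6,-2]$. Let $S$ be the set of the following $13$ points: $[0,0,0,0]$, $[-9,5,-1,1]$, $[-8,4,0,0]$, $[-6,4,2,0]$, $[-5,3,3,-1]$, $[-3,3,-1,1]$, $[-2,2,0,0]$, $[1,1,3,-1]$, $[5,-1,-1,1]$, $[6,-2,0,0]$, $[8,-2,2,0]$, $[9,-3,3,-1]$, $[14,-6,0,0]$. Let $G_{121}$ be the graph with vertex set $\bigcup_{\mathbf{s}\in S}\langle \mathbf{s}\rangle$ in which two vertices $\mathbf{u},\mathbf{v}$ are adjacent if and only if $\mathbf{u}-\mathbf{v}\in W_{50}$.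 Then $G_{121}$ has $121$ vertices and $680$ edges, and its chromatic number is $5$. Hence $\chi(\mathbf{R}^2,C)\ge 5$ when $C$ is a regular decagon centered at the origin.
   Context: For a closed convex curve $C\subset\mathbf{R}^2$ symmetric with respect to the origin, $(\mathbf{R}^2,C)$ denotes the Minkowski plane with unit circle $C$: two points $\mathbf{x},\mathbf{y}\in\mathbf{R}^2$ are at Minkowski distance $1$ if $\mathbf{x}-\mathbf{y}\in C$. The chromatic number $\chi(\mathbf{R}^2,C)$ is the least number of colors needed to color all points of $\mathbf{R}^2$ so that no two points at Minkowski distance $1$ receive the same color. A regular decagon here means the boundary curve of the polygon. The decagon used for the coordinates is the one with vertices $(2\cos k\theta,2\sin k\theta)$, $k=0,\dots,9$, where $\theta=\pi/5$, i.e. with vertex set $\langle\mathbf{a}_1\rangle$ (note $\mathbf{a}_1=(2,0)$ since $\cos\theta=(1+\sqrt5)/4$); all vectors of $W_{50}$ lie on it. *)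

theory Defs
  imports "HOL-Analysis.Analysis" "HOL-Library.Extended_Nat"
begin

definition edge_set :: "'a set \<Rightarrow> ('a \<Rightarrow> 'a \<Rightarrow> bool) \<Rightarrow> 'a set set" where
  "edge_set V adj = {{u, v} | u v. u \<in> V \<and> v \<in> V \<and> adj u v}"

definition proper_coloring :: "'a set \<Rightarrow> ('a \<Rightarrow> 'a \<Rightarrow> bool) \<Rightarrow> nat \<Rightarrow> ('a \<Rightarrow> nat) \<Rightarrow> bool" where
  "proper_coloring V adj k c \<longleftrightarrow>
     c ` V \<subseteq> {..<k} \<and> (\<forall>u\<in>V. \<forall>v\<in>V. adj u v \<longrightarrow> c u \<noteq> c v)"

(* The value is \<infinity> if no finite number of colors suffices. *)
definition chromatic_number :: "'a set \<Rightarrow> ('a \<Rightarrow> 'a \<Rightarrow> bool) \<Rightarrow> enat" where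
  "chromatic_number V adj = Inf {enat k | k. \<exists>c. proper_coloring V adj k c}"

definition minkowski_chromatic_number :: "(real \<times> real) set \<Rightarrow> enat" where
  "minkowski_chromatic_number C =
     chromatic_number (UNIV :: (real \<times> real) set) (\<lambda>x y. x - y \<in> C)"

(* A decagon is a curve here: the boundary, not the filled polygon.
   The radius and the orientation are arbitrary. *)
definition regular_decagon_at_origin :: "(real \<times> real) set \<Rightarrow> bool" where
  "regular_decagon_at_origin C \<longleftrightarrow>
     (\<exists>r \<phi> :: real. r > 0 \<and>
        C = frontier (convex hull
              ((\<lambda>k::nat. (r * cos (\<phi> + real k * pi / 5), r * sin (\<phi> + real k * pi / 5))) ` {0..9})))"

definition rotate_plane :: "real \<Rightarrow> real \<times> real \<Rightarrow> real \<times> real" where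
  "rotate_plane \<phi> p =
     (cos \<phi> * fst p - sin \<phi> * snd p, sin \<phi> * fst p + cos \<phi> * snd p)"

definition orbit10 :: "real \<times> real \<Rightarrow> (real \<times> real) set" where
  "orbit10 p = (\<lambda>k::nat. rotate_plane (real k * pi / 5) p) ` {0..9}"

definition pt :: "int \<Rightarrow> int \<Rightarrow> int \<Rightarrow> int \<Rightarrow> real \<times> real" where
  "pt a b c d =
     ((of_int a + of_int b * sqrt 5) * cos (pi / 5), (of_int c + of_int d * sqrt 5) * sin (pi / 5))"

definition W50 :: "(real \<times> real) set" where
  "W50 = orbit10 (pt (-2) 2 0 0) \<union> orbit10 (pt 9 (-3) 3 (-1)) \<union> orbit10 (pt (-9) 5 (-1) 1)
       \<union> orbit10 (pt (-20) 10 (-4) 2) \<union> orbit10 (pt 20 (-8) 6 (-2))"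

definition S13 :: "(real \<times> real) set" where
  "S13 = {pt 0 0 0 0, pt (-9) 5 (-1) 1, pt (-8) 4 0 0, pt (-6) 4 2 0, pt (-5) 3 3 (-1),
          pt (-3) 3 (-1) 1, pt (-2) 2 0 0, pt 1 1 3 (-1), pt 5 (-1) (-1) 1, pt 6 (-2) 0 0,
          pt 8 (-2) 2 0, pt 9 (-3) 3 (-1), pt 14 (-6) 0 0}"

definition V121 :: "(real \<times> real) set" where
  "V121 = (\<Union>s\<in>S13. orbit10 s)"

definition adj121 :: "real \<times> real \<Rightarrow> real \<times> real \<Rightarrow> bool" where
  "adj121 u v \<longleftrightarrow> u - v \<in> W50"

end

theory Submission
  imports Defs
begin

text \<open>
  Up to a factor of 2, all points involved are elements of the ring \<open>\<int>[\<zeta>]\<close> of the tenth roots of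
  unity, which is free of rank 4 over the integers, so that the graph becomes a finite object over
  integer quadruples and its adjacency relation can be decided by computation. After the colors of
  one triangle have been fixed, the absence of a 4-coloring is a propositional problem in four
  variables per vertex that is refuted by resolution. The decagon enters through the fact that
  \<open>W50\<close> lies on its boundary, where the outer normals of the edges give supporting lines; a
  similarity maps \<open>G\<^sub>1\<^sub>2\<^sub>1\<close> into the unit-distance graph of any centered regular decagon.
\<close>

section \<open>Decagonal lattice points\<close>

type_synonym lattice = "int \<times> int \<times> int \<times> int"

text \<open>
  The tuple \<open>(a, b, c, d)\<close> encodes \<open>2 (a + b \<zeta> + c \<zeta>\<^sup>2 + d \<zeta>\<^sup>3)\<close> with \<open>\<zeta> = exp (i \<pi> / 5)\<close>,
  so that rotation by \<open>\<pi> / 5\<close> is multiplication by \<open>\<zeta>\<close>, where \<open>\<zeta>\<^sup>4 = \<zeta>\<^sup>3 - \<zeta>\<^sup>2 + \<zeta> - 1\<close>.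
\<close>
fun emb :: "lattice \<Rightarrow> real \<times> real" where
  "emb (a, b, c, d) = pt (-2*a + 2*b + 3*c - 3*d) (2*a - c + d) (2*b + c + d) (c + d)"

fun rot :: "lattice \<Rightarrow> lattice" where
  "rot (a, b, c, d) = (- d, a + d, b - d, c + d)"

fun orb :: "nat \<Rightarrow> lattice \<Rightarrow> lattice list" where
  "orb 0 x = []"
| "orb (Suc n) x = x # orb n (rot x)"

lemma orb_numeral: "orb (numeral n) x = x # orb (pred_numeral n) (rot x)"
  by (simp add: numeral_eq_Suc)

lemma set_orb: "set (orb n x) = (\<lambda>k. (rot ^^ k) x) ` {..<n}"
  by (induction n arbitrary: x) (simp_all add: lessThan_Suc_eq_insert_0 image_image funpow_swap1)

lemma rot_funpow_10: "(rot ^^ 10) x = x"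
  by (cases x) (simp add: numeral_eq_Suc)

lemma rot_in_orb:
  assumes "y \<in> set (orb 10 x)"
  shows "rot y \<in> set (orb 10 x)"
proof -
  obtain k where k: "k < 10" "y = (rot ^^ k) x"
    using assms by (auto simp: set_orb)
  show ?thesis
  proof (cases "Suc k = 10")
    case True
    have "rot y = (rot ^^ 10) x"
      unfolding True[symmetric] k(2) by simp
    then have "rot y = x" by (simp add: rot_funpow_10)
    then show ?thesis by (simp add: numeral_eq_Suc)
  next
    case False
    then show ?thesis
      using k by (force simp: set_orb intro!: image_eqI[where x = "Suc k"])
  qed
qed

lemma rot_diff: "rot (x - y) = rot x - rot y"
  by (cases x; cases y) simp

section \<open>Trigonometric values at \<open>pi / 5\<close>, irrationality of
  \<open>sqrt 5\<close>, and injectivity of the encoding\<close>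

lemma cos_pi_fifth: "cos (pi / 5) = (1 + sqrt 5) / 4"
proof -
  define c where "c = cos (pi / 5)"
  have "c > 0" unfolding c_def by (rule cos_gt_zero) auto
  have "cos (3 * (pi / 5)) = - cos (2 * (pi / 5))"
    using cos_pi_minus[of "2 * (pi / 5)"] by (simp add: field_simps)
  then have "4 * c ^ 3 - 3 * c = - (2 * c\<^sup>2 - 1)"
    unfolding c_def cos_treble_cos cos_double_cos by simp
  \<comment> \<open>The left side is four times \<open>4 * c ^ 3 + 2 * c ^ 2 - 3 * c - 1\<close>,
    which has the root -1.\<close>
  then have "(c + 1) * ((4 * c - 1)\<^sup>2 - 5) = 0" by algebra
  then have 1: "(4 * c - 1)\<^sup>2 = 5" using \<open>c > 0\<close> by simp
  moreover have "4 * c - 1 > 0"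
  proof (rule ccontr)
    assume "\<not> ?thesis"
    then have "\<bar>4 * c - 1\<bar> \<le> 1" using \<open>c > 0\<close> by simp
    then have "(4 * c - 1)\<^sup>2 \<le> 1" by (simp add: abs_square_le_1)
    with 1 show False by simp
  qed
  ultimately have "sqrt 5 = 4 * c - 1" by (intro real_sqrt_unique) auto
  then show ?thesis by (simp add: c_def)
qed

lemma sin_pi_fifth_sq: "(sin (pi / 5))\<^sup>2 = (5 - sqrt 5) / 8"
  using sin_squared_eq[of "pi / 5"] by (simp add: cos_pi_fifth power2_eq_square field_simps)

lemma sin_pi_fifth_pos: "sin (pi / 5) > 0"
  by (rule sin_gt_zero) auto

lemma sqrt_5_irrational: "sqrt 5 \<notin> \<rat>"
proof
  assume "sqrt 5 \<in> \<rat>"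
  then obtain m n :: nat where n: "n \<noteq> 0" "\<bar>sqrt 5\<bar> = real m / real n" "coprime m n"
    by (rule Rats_abs_nat_div_natE)
  then have "(real m)\<^sup>2 = 5 * (real n)\<^sup>2"
    by (simp add: field_simps) (metis mult.commute power_mult_distrib real_sqrt_pow2 zero_le_numeral)
  then have eq: "m\<^sup>2 = 5 * n\<^sup>2" by (metis of_nat_eq_iff of_nat_mult of_nat_numeral of_nat_power)
  have "prime (5 :: nat)" by simp
  then have "5 dvd m" using eq by (metis dvd_triv_left prime_dvd_power)
  then obtain k where "m = 5 * k" ..
  then have "n\<^sup>2 = 5 * k\<^sup>2" using eq by (simp add: power2_eq_square)
  then have "5 dvd n" using \<open>prime 5\<close> by (metis dvd_triv_left prime_dvd_power)
  then show False using \<open>5 dvd m\<close> n(3)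
    by (metis coprime_common_divisor_nat numeral_One numeral_eq_iff semiring_norm(86))
qed

lemma int_lincomb_sqrt5_inj:
  assumes "real_of_int a + real_of_int b * sqrt 5 = real_of_int c + real_of_int d * sqrt 5"
  shows "a = c \<and> b = d"
proof (cases "b = d")
  case False
  then have "sqrt 5 = (real_of_int a - real_of_int c) / (real_of_int d - real_of_int b)"
    using assms by (simp add: field_simps)
  then have "sqrt 5 \<in> \<rat>" by simp
  then show ?thesis using sqrt_5_irrational by simp
qed (use assms in auto)

text \<open>Irrationality of \<open>sqrt 5\<close> makes the four integers determined by the point,
  so equality of points is decidable on quadruples.\<close>

lemma pt_inj: "pt a b c d = pt a' b' c' d' \<longleftrightarrow> a = a' \<and> b = b' \<and> c = c' \<and> d = d'"
proof -
  have "cos (pi / 5) \<noteq> 0" unfolding cos_pi_fifth by (smt (verit) real_sqrt_ge_0_iff divide_eq_0_iff)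
  then show ?thesis
    using int_lincomb_sqrt5_inj[of a b a' b'] int_lincomb_sqrt5_inj[of c d c' d'] sin_pi_fifth_pos
    unfolding pt_def by auto
qed

lemma inj_emb: "inj emb"
proof -
  have "emb x = emb y \<Longrightarrow> x = y" for x y
    by (cases x; cases y) (auto simp: pt_inj)
  then show ?thesis by (rule injI)
qed

lemma emb_diff: "emb x - emb y = emb (x - y)"
  by (cases x; cases y) (simp add: pt_def algebra_simps)

lemma rotate_plane_emb: "rotate_plane (pi / 5) (emb x) = emb (rot x)"
proof -
  have ss: "sin (pi / 5) * sin (pi / 5) = (5 - sqrt 5) / 8"
    using sin_pi_fifth_sq by (simp add: power2_eq_square)
  \<comment> \<open>\<open>ss'\<close> and \<open>5\<close> reduce squares inside right-nested
    products, the form that \<open>algebra_simps\<close> produces.\<close>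
  have ss': "sin (pi / 5) * (sin (pi / 5) * A) = (5 - sqrt 5) / 8 * A" for A
    by (simp only: ss flip: mult.assoc)
  have 5: "sqrt 5 * (sqrt 5 * A) = 5 * A" for A
    by (simp flip: mult.assoc)
  show ?thesis
    by (cases x) (simp add: rotate_plane_def pt_def ss ss' 5 cos_pi_fifth algebra_simps
      add_divide_distrib diff_divide_distrib)
qed

declare emb.simps [simp del]

lemma rotate_plane_add: "rotate_plane (\<alpha> + \<beta>) p = rotate_plane \<alpha> (rotate_plane \<beta> p)"
  by (simp add: rotate_plane_def cos_add sin_add algebra_simps)

lemma rotate_plane_emb_funpow: "rotate_plane (real k * pi / 5) (emb x) = emb ((rot ^^ k) x)"
proof (induction k)
  case 0
  show ?case by (simp add: rotate_plane_def)
next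
  case (Suc k)
  have "real (Suc k) * pi / 5 = pi / 5 + real k * pi / 5" by (simp add: field_simps)
  then show ?case
    by (simp only: rotate_plane_add Suc rotate_plane_emb funpow.simps comp_apply)
qed

lemma orbit10_emb: "orbit10 (emb x) = emb ` set (orb 10 x)"
proof -
  have "{0..9} = {..<10::nat}" by auto
  then show ?thesis
    by (simp only: orbit10_def rotate_plane_emb_funpow set_orb image_image)
qed

definition W_list :: "lattice list" where
  "W_list = concat (map (orb 10)
    [(1, 0, 0, 0), (-1, 2, 0, -1), (2, -1, 0, 1), (4, -3, 0, 2), (-3, 4, 0, -2)])"

lemma W50_eq: "W50 = emb ` set W_list"
proof -
  have "W50 = orbit10 (emb (1, 0, 0, 0)) \<union> orbit10 (emb (-1, 2, 0, -1)) \<union> orbit10 (emb (2, -1, 0, 1))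
      \<union> orbit10 (emb (4, -3, 0, 2)) \<union> orbit10 (emb (-3, 4, 0, -2))"
    by (simp add: W50_def emb.simps)
  then show ?thesis
    by (simp only: orbit10_emb W_list_def concat.simps list.map set_append set_simps image_Un
      Un_empty_right image_empty Un_assoc)
qed

text \<open>
  The two numbers are the colors of the even and of the odd rotation images of the point in a
  proper 5-coloring, which was found by computer search; the origin is colored separately below.
\<close>
definition colored_reps :: "(lattice \<times> nat \<times> nat) list" where
  "colored_reps = [
    ((2, -1, 0, 1), 3, 1), ((1, 0, -1, 1), 0, 0), ((1, 1, -1, 1), 4, 2), ((0, 2, -2, 1), 4, 2),
    ((2, -1, 1, 0), 0, 2), ((1, 0, 0, 0), 3, 1), ((0, 2, -1, 0), 4, 2), ((1, -1, 2, -1), 4, 2),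
    ((0, 0, 1, -1), 1, 3), ((0, 1, 1, -1), 4, 0), ((-1, 2, 0, -1), 1, 3), ((-1, 0, 2, -2), 0, 0)]"

definition V_list :: "lattice list" where
  "V_list = (0, 0, 0, 0) # concat (map (\<lambda>(x, _). orb 10 x) colored_reps)"

lemma S13_eq: "S13 = emb ` set ((0, 0, 0, 0) # map fst colored_reps)"
  by (simp add: S13_def colored_reps_def emb.simps)

lemma V121_eq: "V121 = emb ` set V_list"
proof -
  \<comment> \<open>The orbit of the origin collapses to one point, which \<open>V_list\<close>
    accordingly lists once.\<close>
  have 0: "set (orb 10 (0, 0, 0, 0)) = {(0, 0, 0, 0)}" by (simp add: orb_numeral)
  have "V121 = emb ` (\<Union>x\<in>set ((0, 0, 0, 0) # map fst colored_reps). set (orb 10 x))"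
    by (auto simp only: V121_def S13_eq UN_simps orbit10_emb image_UN)
  also have "(\<Union>x\<in>set ((0, 0, 0, 0) # map fst colored_reps). set (orb 10 x)) = set V_list"
    unfolding V_list_def set_simps UN_insert 0 set_concat by auto
  finally show ?thesis .
qed

lemma distinct_W_list: "distinct W_list"
  by code_simp

lemma distinct_V_list: "distinct V_list"
  by code_simp

lemma card_W50: "card W50 = 50"
proof -
  have "length W_list = 50" by code_simp
  then show ?thesis
    using distinct_card[OF distinct_W_list]
    by (simp add: W50_eq card_image inj_on_subset[OF inj_emb])
qed

lemma card_V121: "card V121 = 121"
proof -
  have "length V_list = 121" by code_simp
  then show ?thesis
    using distinct_card[OF distinct_V_list]
    by (simp add: V121_eq card_image inj_on_subset[OF inj_emb])
qed

lemma card_S13: "card S13 = 13"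
proof -
  have "distinct ((0, 0, 0, 0) # map fst colored_reps)"
      "length ((0, 0, 0, 0) # map fst colored_reps) = 13"
    by code_simp+
  then have "card (set ((0, 0, 0, 0) # map fst colored_reps)) = 13"
    by (metis distinct_card)
  then show ?thesis
    by (simp only: S13_eq card_image[OF inj_on_subset[OF inj_emb subset_UNIV]])
qed

lemma adj121_emb: "adj121 (emb x) (emb y) \<longleftrightarrow> x - y \<in> set W_list"
  by (simp add: adj121_def W50_eq emb_diff inj_image_mem_iff[OF inj_emb])

section \<open>Counting the edges\<close>

text \<open>
  In terms of the undoubled point \<open>x = a + b \<zeta> + c \<zeta>\<^sup>2 + d \<zeta>\<^sup>3\<close>, one has
  \<open>\<bar>x\<bar>\<^sup>2 = A + B \<phi>\<close> with \<open>\<phi> = (1 + sqrt 5) / 2\<close> and \<open>A\<close>, \<open>B\<close> as below. The squared norms of the five generators of \<open>W50\<close> are \<open>1\<close>, \<open>9 - 5 \<phi>\<close> (twice) and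
  \<open>43 - 26 \<phi>\<close> (twice). Testing them is cheaper than searching \<open>W_list\<close>.
\<close>
fun W_norm :: "lattice \<Rightarrow> bool" where
  "W_norm (a, b, c, d) =
    (let C = a*c + b*d - a*d;
         A = a*a + b*b + c*c + d*d - C;
         B = a*b + b*c + c*d + C
     in if A = 1 then B = 0 else if A = 9 then B = -5 else if A = 43 then B = -26 else False)"

lemma W_norm_uminus: "W_norm (- x) = W_norm x"
  by (cases x) (simp add: Let_def)

declare W_norm.simps [simp del]

lemma W_list_norm: "x \<in> set W_list \<Longrightarrow> W_norm x"
proof -
  have "\<forall>x\<in>set W_list. W_norm x" by code_simp
  then show "x \<in> set W_list \<Longrightarrow> W_norm x" by blast
qed

lemma zero_notin_W_list: "0 \<notin> set W_list"
  using W_list_norm[of 0] by (auto simp: zero_prod_def W_norm.simps)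

lemma W_list_rot: "x \<in> set W_list \<Longrightarrow> rot x \<in> set W_list"
  unfolding W_list_def set_concat set_map by (blast intro: rot_in_orb)

text \<open>Five rotation steps are the point reflection, since the fifth power of the root of unity
  is -1.\<close>

lemma W_list_uminus: "x \<in> set W_list \<Longrightarrow> - x \<in> set W_list"
proof -
  assume "x \<in> set W_list"
  then have "(rot ^^ 5) x \<in> set W_list"
    by (simp add: numeral_eq_Suc W_list_rot)
  moreover have "(rot ^^ 5) x = - x"
    by (cases x) (simp add: numeral_eq_Suc)
  ultimately show ?thesis by simp
qed

lemma V_list_rot:
  assumes "x \<in> set V_list"
  shows "rot x \<in> set V_list"
proof -
  have V: "set V_list = insert (0, 0, 0, 0) (\<Union>r\<in>set colored_reps. set (orb 10 (fst r)))"
    unfolding V_list_def by (simp add: case_prod_beta)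
  from assms have "x = (0, 0, 0, 0) \<or> (\<exists>r\<in>set colored_reps. x \<in> set (orb 10 (fst r)))"
    unfolding V by blast
  then show ?thesis
  proof
    assume "x = (0, 0, 0, 0)"
    then show ?thesis by (simp add: V)
  next
    assume "\<exists>r\<in>set colored_reps. x \<in> set (orb 10 (fst r))"
    then show ?thesis unfolding V using rot_in_orb by blast
  qed
qed

fun count_pairs :: "('a \<Rightarrow> 'a \<Rightarrow> bool) \<Rightarrow> 'a list \<Rightarrow> nat" where
  "count_pairs R [] = 0"
| "count_pairs R (x # xs) = length (filter (R x) xs) + count_pairs R xs"

lemma finite_edge_set: "finite V \<Longrightarrow> finite (edge_set V R)"
  by (rule finite_subset[of _ "Pow V"]) (auto simp: edge_set_def)

text \<open>Each edge is counted at whichever of its ends comes first in the list; distinctness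
  keeps the edges at the head apart from those within the tail.\<close>

lemma card_edge_set:
  assumes "distinct xs" "\<And>x y. R x y \<Longrightarrow> R y x" "\<And>x. \<not> R x x"
  shows "card (edge_set (set xs) R) = count_pairs R xs"
  using assms(1)
proof (induction xs)
  case Nil
  show ?case by (simp add: edge_set_def)
next
  case (Cons x xs)
  let ?N = "(\<lambda>y. {x, y}) ` set (filter (R x) xs)"
  have "edge_set (set (x # xs)) R = ?N \<union> edge_set (set xs) R"
    using assms(2,3) by (auto simp: edge_set_def insert_commute)
  moreover have "?N \<inter> edge_set (set xs) R = {}"
    using Cons.prems by (auto simp: edge_set_def doubleton_eq_iff)
  moreover have "card ?N = length (filter (R x) xs)"
  proof -
    have "inj_on (\<lambda>y. {x, y}) (set (filter (R x) xs))"
      by (auto simp: inj_on_def doubleton_eq_iff)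
    then show ?thesis
      using Cons.prems distinct_card[of "filter (R x) xs"] by (simp only: card_image) simp
  qed
  ultimately show ?case
    using Cons by (simp add: card_Un_disjoint finite_edge_set)
qed

lemma edge_set_image:
  "edge_set (f ` V) R = (`) f ` edge_set V (\<lambda>x y. R (f x) (f y))"
proof (rule set_eqI)
  fix e
  have "e \<in> edge_set (f ` V) R \<longleftrightarrow> (\<exists>u\<in>V. \<exists>v\<in>V. R (f u) (f v) \<and> e = f ` {u, v})"
    unfolding edge_set_def by auto
  also have "\<dots> \<longleftrightarrow> e \<in> (`) f ` edge_set V (\<lambda>x y. R (f x) (f y))"
    unfolding edge_set_def by blast
  finally show "e \<in> edge_set (f ` V) R \<longleftrightarrow> e \<in> (`) f ` edge_set V (\<lambda>x y. R (f x) (f y))" .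
qed

lemma count_pairs_V_list:
  "count_pairs (\<lambda>x y. if W_norm (x - y) then x - y \<in> set W_list else False) V_list = 680"
  by code_simp

lemma card_edges: "card (edge_set V121 adj121) = 680"
proof -
  let ?R = "\<lambda>x y :: lattice. x - y \<in> set W_list"
  have "inj_on ((`) emb) (edge_set (set V_list) ?R)"
    using inj_on_image_eq_iff[OF inj_emb] by (auto intro!: inj_onI)
  then have "card (edge_set V121 adj121) = card (edge_set (set V_list) ?R)"
    by (simp add: V121_eq edge_set_image adj121_emb card_image)
  also have "\<dots> = count_pairs ?R V_list"
    using W_list_uminus zero_notin_W_list
    by (intro card_edge_set distinct_V_list) (metis minus_diff_eq, simp)
  \<comment> \<open>Every element of \<open>W_list\<close> passes the norm test, so the guard leaves
    the relation unchanged.\<close>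
  also have "?R = (\<lambda>x y. if W_norm (x - y) then x - y \<in> set W_list else False)"
    using W_list_norm by (auto simp: fun_eq_iff)
  finally show ?thesis by (simp add: count_pairs_V_list)
qed

section \<open>Colorings\<close>

lemma chromatic_number_le:
  "proper_coloring V adj k c \<Longrightarrow> chromatic_number V adj \<le> enat k"
  unfolding chromatic_number_def by (rule Inf_lower) blast

lemma chromatic_number_ge:
  "(\<And>k c. proper_coloring V adj k c \<Longrightarrow> n \<le> k) \<Longrightarrow> enat n \<le> chromatic_number V adj"
  unfolding chromatic_number_def by (rule Inf_greatest) auto

definition coloring :: "(lattice \<times> nat) list" where
  "coloring = ((0, 0, 0, 0), 0) #
    concat (map (\<lambda>(x, i, j). zip (orb 10 x) [i, j, i, j, i, j, i, j, i, j]) colored_reps)"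

text \<open>Allows a symmetric relation to be checked by evaluating each unordered pair only
  once.\<close>

lemma sorted_wrt_symD:
  assumes "sorted_wrt R xs" "x \<in> set xs" "y \<in> set xs" "x \<noteq> y" "\<And>x y. R x y \<Longrightarrow> R y x"
  shows "R x y"
  using assms(1-4) by (induction xs) (auto intro: assms(5))

lemma five_coloring: "\<exists>c. proper_coloring V121 adj121 5 c"
proof -
  \<comment> \<open>Equally colored points are required to fail even the norm test, a cheaper
    condition that implies non-adjacency.\<close>
  let ?R = "\<lambda>(x, i) (y, j). if i = j then \<not> W_norm (x - y) else True"
  define c where "c p = the (map_of coloring (inv emb p))" for p
  have c_emb: "c (emb x) = the (map_of coloring x)" for x
    by (simp add: c_def inj_emb)
  have "map fst coloring = V_list"
    by code_simp
  \<comment> \<open>The keys of \<open>coloring\<close> are exactly the vertices, so the lookup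
    never yields the unspecified \<open>the None\<close>.\<close>
  have dom: "(x, c (emb x)) \<in> set coloring" if "x \<in> set V_list" for x
  proof -
    have "x \<in> fst ` set coloring"
      using that \<open>map fst coloring = V_list\<close> by (metis list.set_map)
    then obtain i where "map_of coloring x = Some i"
      by (metis map_of_eq_None_iff not_None_eq)
    then show ?thesis by (simp add: c_emb map_of_SomeD)
  qed
  have "sorted_wrt ?R coloring" by code_simp
  have proper: "c (emb x) \<noteq> c (emb y)"
    if "x \<in> set V_list" "y \<in> set V_list" "x - y \<in> set W_list" for x y
  proof
    assume eq: "c (emb x) = c (emb y)"
    have "x \<noteq> y" using that(3) zero_notin_W_list by auto
    have "?R (x, c (emb x)) (y, c (emb y))"
    proof (rule sorted_wrt_symD[OF \<open>sorted_wrt ?R coloring\<close>])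
      show "(x, c (emb x)) \<in> set coloring" "(y, c (emb y)) \<in> set coloring"
        using that dom by blast+
      show "(x, c (emb x)) \<noteq> (y, c (emb y))"
        using \<open>x \<noteq> y\<close> by simp
      show "?R b a" if "?R a b" for a b
        using that W_norm_uminus[of "fst a - fst b"]
        by (simp add: case_prod_beta split: if_splits)
    qed
    then show False using eq that(3) W_list_norm by simp
  qed
  have "\<forall>(x, i) \<in> set coloring. i < 5" by code_simp
  from bspec[OF this dom] have "c (emb x) < 5" if "x \<in> set V_list" for x
    using that by simp
  with proper have "proper_coloring V121 adj121 5 c"
    unfolding proper_coloring_def V121_eq by (simp add: adj121_emb image_subset_iff)
  then show ?thesis by blast
qed

section \<open>Impossibility of four colors\<close>

text \<open>One edge from each orbit of edges under rotation by \<open>\<pi> / 5\<close>.\<close>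
definition arcs :: "(lattice \<times> lattice) list" where
  "arcs = [
    ((0, 0, 0, 0), (2, -1, 0, 1)), ((0, 0, 0, 0), (1, 0, 0, 0)), ((0, 0, 0, 0), (-1, 2, 0, -1)),
    ((2, -1, 0, 1), (1, -1, 0, 1)), ((2, -1, 0, 1), (1, -2, 2, 0)),
    ((2, -1, 0, 1), (1, -1, 1, -1)), ((2, -1, 0, 1), (2, -1, 0, 0)),
    ((2, -1, 0, 1), (1, -1, 2, 0)), ((2, -1, 0, 1), (1, 1, -1, 0)),
    ((2, -1, 0, 1), (1, 0, -1, 2)), ((2, -1, 0, 1), (-2, 2, 0, -1)),
    ((2, -1, 0, 1), (2, -2, 0, 1)), ((1, 0, -1, 1), (1, 1, -1, 1)),
    ((1, 0, -1, 1), (2, -2, 2, -1)), ((1, 0, -1, 1), (0, 1, -2, 2)),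
    ((1, 0, -1, 1), (1, -1, -1, 1)), ((1, 0, -1, 1), (0, 0, 1, 0)),
    ((1, 0, -1, 1), (0, 0, 0, -1)), ((1, 0, -1, 1), (0, 2, -1, 0)),
    ((1, 0, -1, 1), (2, -1, 0, 0)), ((1, 0, -1, 1), (1, 0, 0, 1)),
    ((1, 0, -1, 1), (1, 0, -1, 0)), ((1, 0, -1, 1), (0, -1, 1, 0)),
    ((1, 0, -1, 1), (0, 0, -1, 1)), ((1, 0, -1, 1), (-1, 1, -1, 0)),
    ((1, 0, -1, 1), (1, 0, -1, 2)), ((1, 1, -1, 1), (2, -2, 1, 0)),
    ((1, 1, -1, 1), (0, 0, 1, 0)), ((1, 1, -1, 1), (0, 1, 0, -1)),
    ((1, 1, -1, 1), (0, 1, -1, 1)), ((1, 1, -1, 1), (1, 1, -1, 0)),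
    ((1, 1, -1, 1), (1, 1, -2, 1)), ((0, 2, -2, 1), (0, 2, -1, 1)),
    ((0, 2, -2, 1), (2, -1, 0, 0)), ((0, 2, -2, 1), (-1, 1, 0, 0)),
    ((0, 2, -2, 1), (1, -1, 0, 0)), ((0, 2, -2, 1), (1, 1, -1, 0)),
    ((0, 2, -2, 1), (1, 0, -1, 2)), ((0, 2, -2, 1), (1, 0, -2, 2)),
    ((0, 2, -2, 1), (-2, 3, -2, 0)), ((2, -1, 1, 0), (0, 2, -1, 1)),
    ((2, -1, 1, 0), (2, -1, 0, 0)), ((2, -1, 1, 0), (1, 0, 0, 1)),
    ((2, -1, 1, 0), (0, 0, 1, -1)), ((2, -1, 1, 0), (1, -1, 1, 0)),
    ((2, -1, 1, 0), (1, -2, 3, -1)), ((2, -1, 1, 0), (1, 1, -2, 1)),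
    ((1, 0, 0, 0), (0, 0, 2, -1)), ((1, 0, 0, 0), (1, 0, 0, 1)), ((1, 0, 0, 0), (1, 0, -1, 0)),
    ((1, 0, 0, 0), (0, 1, -1, 1)), ((1, 0, 0, 0), (1, -1, 0, 0)),
    ((1, 0, 0, 0), (2, -3, 2, -1)), ((1, 0, 0, 0), (0, 2, -3, 2)),
    ((1, 0, 0, 0), (2, -2, 0, 1)), ((0, 2, -1, 0), (1, 0, 0, 1)),
    ((0, 2, -1, 0), (0, 1, -1, 0)), ((1, -1, 2, -1), (0, 1, -1, 1)),
    ((1, -1, 2, -1), (0, 1, -1, 0)), ((1, -1, 2, -1), (1, -1, 2, 0)),
    ((1, -1, 2, -1), (-1, 0, 2, -2)), ((1, -1, 2, -1), (2, -3, 2, 0)),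
    ((0, 0, 1, -1), (-1, 1, 0, 0)), ((0, 0, 1, -1), (0, 1, 1, -1)),
    ((0, 0, 1, -1), (1, 1, -1, 0)), ((0, 1, 1, -1), (1, -1, 2, 0)),
    ((-1, 2, 0, -1), (-2, 2, 0, -1)), ((-1, 2, 0, -1), (2, -2, 0, 1))]"

definition edges :: "(lattice \<times> lattice) list" where
  "edges = concat (map (\<lambda>e. zip (orb 10 (fst e)) (orb 10 (snd e))) arcs)"

text \<open>Rotation is an automorphism of the graph, so adjacency has to be evaluated for the
  representatives in \<open>arcs\<close> only.\<close>

lemma zip_orb_adjacent:
  assumes "(u, v) \<in> set (zip (orb n x) (orb n y))"
    and "x \<in> set V_list" "y \<in> set V_list" "x - y \<in> set W_list"
  shows "u \<in> set V_list \<and> v \<in> set V_list \<and> u - v \<in> set W_list"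
  using assms
proof (induction n arbitrary: x y)
  case (Suc n)
  have rots: "rot x \<in> set V_list" "rot y \<in> set V_list" "rot x - rot y \<in> set W_list"
    using Suc.prems(2-4) V_list_rot W_list_rot rot_diff by metis+
  from Suc.prems(1) consider "u = x \<and> v = y" | "(u, v) \<in> set (zip (orb n (rot x)) (orb n (rot y)))"
    by auto
  then show ?case
    using Suc.prems(2-4) Suc.IH[OF _ rots] by cases blast+
qed simp

lemma edges_adjacent:
  assumes "(u, v) \<in> set edges"
  shows "u \<in> set V_list \<and> v \<in> set V_list \<and> u - v \<in> set W_list"
proof -
  obtain e where e: "e \<in> set arcs" and uv: "(u, v) \<in> set (zip (orb 10 (fst e)) (orb 10 (snd e)))"
    using assms unfolding edges_def set_concat set_map by blast
  have "\<forall>e\<in>set arcs. fst e \<in> set V_list \<and> snd e \<in> set V_list \<and> fst e - snd e \<in> set W_list"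
    by code_simp
  with e uv show ?thesis using zip_orb_adjacent by blast
qed

text \<open>The predicates are the color classes; the vertices in the last three premises span a triangle.\<close>
lemma edges_not_four_colorable:
  fixes A B C D :: "lattice \<Rightarrow> bool"
  assumes "list_all (\<lambda>x. A x \<or> B x \<or> C x \<or> D x) V_list"
    and "list_all (\<lambda>(x, y). A x \<longrightarrow> \<not> A y) edges" "list_all (\<lambda>(x, y). B x \<longrightarrow> \<not> B y) edges"
      "list_all (\<lambda>(x, y). C x \<longrightarrow> \<not> C y) edges" "list_all (\<lambda>(x, y). D x \<longrightarrow> \<not> D y) edges"
    and "A (0, 0, 0, 0)" "B (2, -1, 0, 1)" "C (1, -1, 1, -1)"
  shows False
proof -
  note [simp] = orb_numeral
  show False
    \<comment> \<open>Simplification expands the orbits, leaving propositional formulas whose atoms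
      are the color predicates at explicit quadruples.\<close>
    using assms(1)[unfolded V_list_def colored_reps_def, simplified]
      assms(2-5)[unfolded edges_def arcs_def, simplified] assms(6-8)
    by sat
qed

text \<open>The color classes are named after the colors on a triangle, which breaks the symmetry
  without permuting the coloring.\<close>

lemma V121_not_four_colorable:
  assumes "proper_coloring V121 adj121 k c"
  shows "5 \<le> k"
proof (rule ccontr)
  assume "\<not> 5 \<le> k"
  let ?f = "\<lambda>x. c (emb x)"
  have f_less: "?f x < 4" if "x \<in> set V_list" for x
    using assms that \<open>\<not> 5 \<le> k\<close> by (force simp: proper_coloring_def V121_eq)
  have f_proper: "?f x \<noteq> ?f y" if "x \<in> set V_list" "y \<in> set V_list" "x - y \<in> set W_list" for x y
    using assms that by (simp add: proper_coloring_def V121_eq adj121_emb)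
  let ?o = "(0, 0, 0, 0) :: lattice" and ?p = "(2, -1, 0, 1) :: lattice" and ?q = "(1, -1, 1, -1) :: lattice"
  have mem: "?o \<in> set V_list" "?p \<in> set V_list" "?q \<in> set V_list"
      "?o - ?p \<in> set W_list" "?o - ?q \<in> set W_list" "?p - ?q \<in> set W_list"
    by code_simp+
  note f_proper[OF mem(1,2,4)] f_proper[OF mem(1,3,5)] f_proper[OF mem(2,3,6)]
    f_less[OF mem(1)] f_less[OF mem(2)] f_less[OF mem(3)]
  \<comment> \<open>The triangle uses three of the four available colors, so exactly one color
    \<open>d\<close> remains.\<close>
  then have "card ({..<4} - {?f ?o, ?f ?p, ?f ?q}) = 1"
    by (subst card_Diff_subset) auto
  then obtain d where d: "{..<4} - {?f ?o, ?f ?p, ?f ?q} = {d}"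
    by (rule card_1_singletonE)
  then have colors: "{..<4} \<subseteq> {?f ?o, ?f ?p, ?f ?q, d}" by blast
  have "?f x \<noteq> ?f y" if "(x, y) \<in> set edges" for x y
    using edges_adjacent[OF that] f_proper by blast
  then have edge: "list_all (\<lambda>(x, y). ?f x = i \<longrightarrow> ?f y \<noteq> i) edges" for i
    unfolding list_all_iff by (intro ballI case_prodI2) blast
  have "?f x \<in> {?f ?o, ?f ?p, ?f ?q, d}" if "x \<in> set V_list" for x
    using f_less[OF that] colors by blast
  then have "list_all (\<lambda>x. ?f x = ?f ?o \<or> ?f x = ?f ?p \<or> ?f x = ?f ?q \<or> ?f x = d) V_list"
    unfolding list_all_iff by simp
  from edges_not_four_colorable[OF this edge edge edge edge refl refl refl] show False .
qed

lemma chromatic_number_V121: "chromatic_number V121 adj121 = 5"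
proof (rule antisym)
  show "chromatic_number V121 adj121 \<le> 5"
    using five_coloring chromatic_number_le by (metis numeral_eq_enat)
  show "5 \<le> chromatic_number V121 adj121"
    using chromatic_number_ge[of V121 adj121 5] V121_not_four_colorable
    by (simp add: numeral_eq_enat)
qed

section \<open>The decagon\<close>

text \<open>The hull lies in a closed half-space with \<open>x\<close> on its bounding hyperplane;
  its interior lies in the open half-space, which misses \<open>x\<close>.\<close>

lemma frontier_convex_hull_supporting:
  fixes S :: "'a::euclidean_space set"
  assumes "x \<in> convex hull S" "n \<noteq> 0" "\<And>y. y \<in> S \<Longrightarrow> n \<bullet> y \<le> n \<bullet> x"
  shows "x \<in> frontier (convex hull S)"
proof -
  have "convex hull S \<subseteq> {y. n \<bullet> y \<le> n \<bullet> x}"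
    using assms(3) by (intro hull_minimal) (auto simp: convex_halfspace_le)
  then have "interior (convex hull S) \<subseteq> {y. n \<bullet> y < n \<bullet> x}"
    using interior_mono assms(2) by (metis interior_halfspace_le)
  then show ?thesis
    using assms(1) closure_subset by (auto simp: frontier_def)
qed

lemma cos_le_cos_away_from_zero:
  assumes "0 \<le> a" "a \<le> y" "y \<le> 2 * pi - a"
  shows "cos y \<le> cos a"
proof (cases "y \<le> pi")
  case True
  then show ?thesis using assms by (intro cos_monotone_0_pi_le) auto
next
  case False
  have "cos (2 * pi - y) \<le> cos a"
    using assms False by (intro cos_monotone_0_pi_le) auto
  then show ?thesis by simp
qed

definition decagon_vertex :: "real \<Rightarrow> real \<Rightarrow> nat \<Rightarrow> real \<times> real" where
  "decagon_vertex r \<phi> k = (r * cos (\<phi> + real k * pi / 5), r * sin (\<phi> + real k * pi / 5))"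

lemma decagon_vertex_10: "decagon_vertex r \<phi> 10 = decagon_vertex r \<phi> 0"
proof -
  have "\<phi> + real 10 * pi / 5 = \<phi> + 2 * pi" by simp
  then show ?thesis
    unfolding decagon_vertex_def by (simp only: sin_periodic cos_periodic) simp
qed

text \<open>The supporting normal points towards the midpoint of the edge: both endpoints are at
  angle \<open>pi / 10\<close> from it, and no vertex is closer.\<close>

lemma decagon_edge_in_frontier:
  assumes "r > 0" "0 \<le> t" "t \<le> 1" "m \<le> 9"
  shows "(1 - t) *\<^sub>R decagon_vertex r \<phi> m + t *\<^sub>R decagon_vertex r \<phi> (Suc m)
    \<in> frontier (convex hull (decagon_vertex r \<phi> ` {0..9}))"
proof (rule frontier_convex_hull_supporting)
  define \<alpha> where "\<alpha> = \<phi> + real m * pi / 5 + pi / 10"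
  define n where "n = (cos \<alpha>, sin \<alpha>)"
  show "n \<noteq> 0"
    using sin_cos_squared_add[of \<alpha>] by (auto simp: n_def zero_prod_def simp del: sin_cos_squared_add)
  have inner: "n \<bullet> decagon_vertex r \<phi> i = r * cos ((real i - real m) * pi / 5 - pi / 10)" for i
  proof -
    have "(real i - real m) * pi / 5 - pi / 10 = (\<phi> + real i * pi / 5) - \<alpha>"
      by (simp add: \<alpha>_def field_simps)
    then show ?thesis
      by (simp only: cos_diff) (simp add: n_def decagon_vertex_def algebra_simps)
  qed
  \<comment> \<open>For \<open>m = 9\<close> the successor is index 10, which wraps around to vertex
    0.\<close>
  have "decagon_vertex r \<phi> (Suc m) \<in> decagon_vertex r \<phi> ` {0..9}"
    using assms(4) decagon_vertex_10[of r \<phi>] by (cases "m = 9") auto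
  then show "(1 - t) *\<^sub>R decagon_vertex r \<phi> m + t *\<^sub>R decagon_vertex r \<phi> (Suc m)
      \<in> convex hull (decagon_vertex r \<phi> ` {0..9})"
    using assms by (intro convexD_alt convex_convex_hull) (auto intro: hull_inc)
  have "n \<bullet> decagon_vertex r \<phi> m = r * cos (pi / 10)"
      "n \<bullet> decagon_vertex r \<phi> (Suc m) = r * cos (pi / 10)"
    by (simp_all add: inner)
  then have edge: "n \<bullet> ((1 - t) *\<^sub>R decagon_vertex r \<phi> m + t *\<^sub>R decagon_vertex r \<phi> (Suc m)) = r * cos (pi / 10)"
    by (simp add: inner_add_right algebra_simps)
  fix y
  assume "y \<in> decagon_vertex r \<phi> ` {0..9}"
  then obtain i where i: "i \<le> 9" "y = decagon_vertex r \<phi> i" by auto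
  let ?\<beta> = "(real i - real m) * pi / 5 - pi / 10"
  have "cos ?\<beta> = cos \<bar>?\<beta>\<bar>" by simp
  also have "\<dots> \<le> cos (pi / 10)"
  proof (rule cos_le_cos_away_from_zero)
    \<comment> \<open>The angle is an odd multiple of \<open>pi / 10\<close>, of absolute value
      between 1 and 19 times that unit.\<close>
    have \<beta>: "?\<beta> = pi / 10 * (2 * (real i - real m) - 1)" by (simp add: field_simps)
    have abs: "\<bar>?\<beta>\<bar> = pi / 10 * \<bar>2 * (real i - real m) - 1\<bar>"
      unfolding \<beta> abs_mult by simp
    have "real i \<le> real m \<or> real (Suc m) \<le> real i"
      unfolding of_nat_le_iff by linarith
    then have "1 \<le> \<bar>2 * (real i - real m) - 1\<bar>" by auto
    from mult_left_mono[OF this, of "pi / 10"] show "pi / 10 \<le> \<bar>?\<beta>\<bar>" by (simp add: abs)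
    have "\<bar>2 * (real i - real m) - 1\<bar> \<le> 19"
      using i(1) assms(4) by (auto simp: abs_le_iff)
    from mult_left_mono[OF this, of "pi / 10"] show "\<bar>?\<beta>\<bar> \<le> 2 * pi - pi / 10" by (simp add: abs)
  qed simp
  finally show "n \<bullet> y \<le> n \<bullet> ((1 - t) *\<^sub>R decagon_vertex r \<phi> m + t *\<^sub>R decagon_vertex r \<phi> (Suc m))"
    unfolding edge using assms(1) by (simp add: i(2) inner)
qed

section \<open>Embedding the graph into the unit-distance graph of a decagon\<close>

definition similarity :: "real \<Rightarrow> real \<Rightarrow> real \<times> real \<Rightarrow> real \<times> real" where
  "similarity r \<phi> p = (r / 2) *\<^sub>R rotate_plane \<phi> p"

lemma similarity_diff: "similarity r \<phi> (p - q) = similarity r \<phi> p - similarity r \<phi> q"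
  by (simp add: similarity_def rotate_plane_def algebra_simps)

text \<open>The pair is the point with parameter \<open>t\<close> on the edge starting at
  \<open>(2, 0)\<close> of the decagon of circumradius 2; hence the factor \<open>r / 2\<close> in
  \<open>similarity\<close>.\<close>

lemma similarity_edge_point:
  "similarity r \<phi> (rotate_plane (real k * pi / 5) (2 * (1 - t) + 2 * t * cos (pi / 5), 2 * t * sin (pi / 5)))
    = (1 - t) *\<^sub>R decagon_vertex r \<phi> k + t *\<^sub>R decagon_vertex r \<phi> (Suc k)"
proof -
  have "\<phi> + real (Suc k) * pi / 5 = (\<phi> + real k * pi / 5) + pi / 5" by (simp add: field_simps)
  then show ?thesis
    unfolding decagon_vertex_def
    by (simp only: cos_add sin_add) (simp add: similarity_def rotate_plane_def algebra_simps)
qed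

text \<open>All five generators lie on that one edge, so every vector of \<open>W50\<close> lies on
  a rotated copy of it.\<close>

lemma W50_edge_points:
  assumes "w \<in> W50"
  obtains k :: nat and t where "k \<le> 9" "0 \<le> t" "t \<le> 1"
    "w = rotate_plane (real k * pi / 5) (2 * (1 - t) + 2 * t * cos (pi / 5), 2 * t * sin (pi / 5))"
proof -
  let ?e = "\<lambda>t. (2 * (1 - t) + 2 * t * cos (pi / 5), 2 * t * sin (pi / 5))"
  have "sqrt 5 \<le> sqrt ((9 / 4)\<^sup>2)" by (subst real_sqrt_le_iff) (simp add: power2_eq_square)
  moreover have "sqrt (2\<^sup>2) \<le> sqrt 5" by (subst real_sqrt_le_iff) simp
  ultimately have 5: "2 \<le> sqrt 5" "sqrt 5 \<le> 9 / 4" by simp_all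
  \<comment> \<open>Comparing second coordinates gives the parameter of \<open>pt a b c d\<close> as
    \<open>(c + d * sqrt 5) / 2\<close>.\<close>
  have "pt (-2) 2 0 0 = ?e 0" "pt 9 (-3) 3 (-1) = ?e ((3 - sqrt 5) / 2)"
      "pt (-9) 5 (-1) 1 = ?e ((sqrt 5 - 1) / 2)" "pt (-20) 10 (-4) 2 = ?e (sqrt 5 - 2)"
      "pt 20 (-8) 6 (-2) = ?e (3 - sqrt 5)"
    by (simp_all add: pt_def cos_pi_fifth field_simps)
  then have "W50 = (\<Union>t\<in>{0, (3 - sqrt 5) / 2, (sqrt 5 - 1) / 2, sqrt 5 - 2, 3 - sqrt 5}. orbit10 (?e t))"
    by (simp only: W50_def UN_insert UN_empty Un_empty_right Un_assoc)
  then obtain t where "t \<in> {0, (3 - sqrt 5) / 2, (sqrt 5 - 1) / 2, sqrt 5 - 2, 3 - sqrt 5}"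
      "w \<in> orbit10 (?e t)"
    using assms by blast
  moreover from this(1) have "0 \<le> t" "t \<le> 1" using 5 by auto
  moreover obtain k :: nat where "k \<le> 9" "w = rotate_plane (real k * pi / 5) (?e t)"
    using \<open>w \<in> orbit10 (?e t)\<close> unfolding orbit10_def by (meson atLeastAtMost_iff imageE)
  ultimately show thesis by (intro that)
qed

lemma minkowski_chromatic_number_decagon:
  assumes "regular_decagon_at_origin C"
  shows "5 \<le> minkowski_chromatic_number C"
proof -
  obtain r \<phi> where r: "r > 0" and C: "C = frontier (convex hull (decagon_vertex r \<phi> ` {0..9}))"
    using assms unfolding regular_decagon_at_origin_def decagon_vertex_def by auto
  have "similarity r \<phi> w \<in> C" if w: "w \<in> W50" for w
    using w
  proof (rule W50_edge_points)
    fix k t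
    assume "k \<le> 9" "0 \<le> t" "t \<le> 1"
      and "w = rotate_plane (real k * pi / 5) (2 * (1 - t) + 2 * t * cos (pi / 5), 2 * t * sin (pi / 5))"
    then show ?thesis
      using r unfolding C by (simp only: similarity_edge_point decagon_edge_in_frontier)
  qed
  \<comment> \<open>A coloring of the plane pulls back along the similarity, which respects
    differences and maps \<open>W50\<close> into \<open>C\<close>.\<close>
  then have "proper_coloring V121 adj121 k (c \<circ> similarity r \<phi>)"
    if "proper_coloring UNIV (\<lambda>x y. x - y \<in> C) k c" for k c
    unfolding proper_coloring_def
  proof (intro conjI ballI impI)
    show "(c \<circ> similarity r \<phi>) ` V121 \<subseteq> {..<k}"
      using that unfolding proper_coloring_def by fastforce
    fix u v
    assume "adj121 u v"
    then have "similarity r \<phi> u - similarity r \<phi> v \<in> C"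
      using \<open>\<And>w. w \<in> W50 \<Longrightarrow> similarity r \<phi> w \<in> C\<close> by (metis adj121_def similarity_diff)
    then show "(c \<circ> similarity r \<phi>) u \<noteq> (c \<circ> similarity r \<phi>) v"
      using that unfolding proper_coloring_def comp_apply by blast
  qed
  then have "enat 5 \<le> minkowski_chromatic_number C"
    unfolding minkowski_chromatic_number_def
    by (intro chromatic_number_ge V121_not_four_colorable)
  then show ?thesis by (simp add: numeral_eq_enat)
qed

theorem theorem3p1:
  shows "card W50 = 50 \<and> card S13 = 13 \<and>
    card V121 = 121 \<and>
    card (edge_set V121 adj121) = 680 \<and>
    chromatic_number V121 adj121 = 5 \<and>
    (\<forall>C. regular_decagon_at_origin C \<longrightarrow> minkowski_chromatic_number C \<ge> 5)"
  using card_W50 card_S13 card_V121 card_edges chromatic_number_V121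
    minkowski_chromatic_number_decagon by blast

end
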